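(* The following statements hold: (i) $L$ is an idempotent two-sided ideal of $\mathbb{E}$. (ii) $\langle u\in L\rangle=L$ for every $u\in\mathbb{F}$. (iii) $L\in\mathbf{J}_{\neg\neg}$.
   Context: $\mathbb{E}$ is the monoid, under composition, of all strictly increasing (i.e. monotone and injective) maps $u:\mathbb{N}\to\mathbb{N}$. $\mathbb{F}\subseteq\mathbb{E}$ is the submonoid of those $u\in\mathbb{E}$ whose image $\mathrm{Im}(u)$ is cofinite in $\mathbb{N}$ (has finite complement), and $L=\mathbb{E}\setminus\mathbb{F}$. An ideal of $\mathbb{E}$ means a right ideal: a (possibly empty) subset $I\subseteq\mathbb{E}$ such that $u\in I$, $v\in\mathbb{E}$ imply $u\circ v\in I$. A two-sided ideal is a subset $I$ such that $u\circ v\in I$ and $v\circ u\in I$ whenever $u\in I$, $v\in\mathbb{E}$; it is idempotent if $I\circ I=I$, where $I\circ I=\{u\circ v;\ u,v\in I\}$. For an ideal $I$ of $\mathbb{E}$ and $u\in\mathbb{E}$, $\langle u\in I\rangle=\{v\in\mathbb{E};\ u\circ v\in I\}$. The double negation topology on $\mathbb{E}$ is $$\mathbf{J}_{\neg\neg}=\{I\text{ ideal of }\mathbb{E};\ \forall u\in\mathbb{E},\ \exists v\in\mathbb{E},\ u\circ v\in I\}.$$ *)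

theory Defs
  imports Main
begin

definition monoid_E :: "(nat \<Rightarrow> nat) set" where
  "monoid_E = {u. strict_mono u}"

definition submonoid_F :: "(nat \<Rightarrow> nat) set" where
  "submonoid_F = {u \<in> monoid_E. finite (- range u)}"

definition set_L :: "(nat \<Rightarrow> nat) set" where
  "set_L = monoid_E - submonoid_F"

lemma strict_mono_iff_mono_inj:
  fixes u :: "nat \<Rightarrow> nat"
  shows "strict_mono u \<longleftrightarrow> mono u \<and> inj u"
  by (rule strict_mono_iff_mono)

lemma id_in_monoid_E: "id \<in> monoid_E"
  by (simp add: monoid_E_def strict_mono_def)

lemma comp_in_monoid_E: "u \<in> monoid_E \<Longrightarrow> v \<in> monoid_E \<Longrightarrow> u \<circ> v \<in> monoid_E"
  by (simp add: monoid_E_def strict_mono_def)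

lemma id_in_submonoid_F: "id \<in> submonoid_F"
  by (simp add: submonoid_F_def id_in_monoid_E)

lemma comp_in_submonoid_F:
  assumes "u \<in> submonoid_F" "v \<in> submonoid_F"
  shows "u \<circ> v \<in> submonoid_F"
proof -
  have "- range (u \<circ> v) \<subseteq> - range u \<union> u ` (- range v)"
    by auto
  moreover have "finite (- range u \<union> u ` (- range v))"
    using assms by (simp add: submonoid_F_def)
  ultimately show ?thesis
    using assms by (auto simp: submonoid_F_def intro: comp_in_monoid_E finite_subset)
qed

text \<open>Ideals without further qualification are right ideals, and the empty set is allowed.\<close>

definition is_ideal :: "(nat \<Rightarrow> nat) set \<Rightarrow> bool" where
  "is_ideal I \<longleftrightarrow> I \<subseteq> monoid_E \<and> (\<forall>u\<in>I. \<forall>v\<in>monoid_E. u \<circ> v \<in> I)"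

definition is_two_sided_ideal :: "(nat \<Rightarrow> nat) set \<Rightarrow> bool" where
  "is_two_sided_ideal I \<longleftrightarrow>
     I \<subseteq> monoid_E \<and> (\<forall>u\<in>I. \<forall>v\<in>monoid_E. u \<circ> v \<in> I \<and> v \<circ> u \<in> I)"

definition set_comp :: "(nat \<Rightarrow> nat) set \<Rightarrow> (nat \<Rightarrow> nat) set \<Rightarrow> (nat \<Rightarrow> nat) set" where
  "set_comp I J = {u \<circ> v | u v. u \<in> I \<and> v \<in> J}"

definition is_idempotent :: "(nat \<Rightarrow> nat) set \<Rightarrow> bool" where
  "is_idempotent I \<longleftrightarrow> set_comp I I = I"

text \<open>\<open>ideal_quotient u I\<close> is the set written \<open>\<langle>u \<in> I\<rangle>\<close>.\<close>

definition ideal_quotient :: "(nat \<Rightarrow> nat) \<Rightarrow> (nat \<Rightarrow> nat) set \<Rightarrow> (nat \<Rightarrow> nat) set" where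
  "ideal_quotient u I = {v \<in> monoid_E. u \<circ> v \<in> I}"

definition double_negation_topology :: "(nat \<Rightarrow> nat) set set" where
  "double_negation_topology =
     {I. is_ideal I \<and> (\<forall>u\<in>monoid_E. \<exists>v\<in>monoid_E. u \<circ> v \<in> I)}"

end

theory Submission
  imports Defs "HOL-Library.Infinite_Set"
begin

text \<open>For an injective \<open>u\<close>, the complement of the image of \<open>u \<circ> v\<close> splits into the complement of
  the image of \<open>u\<close> and a bijective copy of the complement of the image of \<open>v\<close>. A composite of two
  strictly increasing maps therefore has infinite co-image (complement of the image) exactly when one of the factors does
  (\<open>comp_in_set_L_iff\<close>). This equivalence says at once that \<open>L\<close> is a two-sided ideal, that
  \<open>u \<circ> v \<in> L\<close> reduces to \<open>v \<in> L\<close> for \<open>u\<close> of cofinite image, and that every \<open>u\<close> is brought into \<open>L\<close>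
  by precomposing with any one element of \<open>L\<close>, such as doubling.

  The only construction is for idempotence: to write \<open>w \<in> L\<close> as a product of two elements of \<open>L\<close>,
  cut the infinite complement of the image of \<open>w\<close> into two infinite pieces \<open>A\<close> and \<open>B\<close>, and
  let \<open>u\<close> enumerate everything outside \<open>B\<close>. Then \<open>u\<close> misses \<open>B\<close>, while \<open>w\<close> factors through \<open>u\<close> by a
  map that misses the copy of \<open>A\<close> (\<open>set_L_factorization\<close>).\<close>

lemma set_L_iff: "u \<in> set_L \<longleftrightarrow> strict_mono u \<and> infinite (- range u)"
  by (auto simp: set_L_def submonoid_F_def monoid_E_def)

text \<open>A point outside the image of \<open>u \<circ> v\<close> is either missed by \<open>u\<close> or is \<open>u\<close> of a point missed
  by \<open>v\<close>; injectivity of \<open>u\<close> makes the converse true and keeps the second part infinite when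
  the complement of the image of \<open>v\<close> is.\<close>

lemma comp_in_set_L_iff:
  assumes "u \<in> monoid_E" "v \<in> monoid_E"
  shows "u \<circ> v \<in> set_L \<longleftrightarrow> u \<in> set_L \<or> v \<in> set_L"
proof -
  have inj: "inj u"
    using assms(1) by (simp add: monoid_E_def strict_mono_imp_inj_on)
  then have "- range (u \<circ> v) = - range u \<union> u ` (- range v)"
    by (auto simp: inj_eq)
  moreover have "finite (u ` (- range v)) \<longleftrightarrow> finite (- range v)"
    using inj by (simp add: finite_image_iff inj_on_subset)
  moreover have "strict_mono (u \<circ> v)"
    using comp_in_monoid_E[OF assms] by (simp add: monoid_E_def)
  ultimately show ?thesis
    using assms by (auto simp: set_L_iff monoid_E_def)
qed

lemma double_in_set_L: "(\<lambda>n. 2 * n) \<in> set_L"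
proof -
  have "range (\<lambda>n::nat. 2 * n + 1) \<subseteq> - range (\<lambda>n. 2 * n)"
    by (auto, presburger)
  moreover have "infinite (range (\<lambda>n::nat. 2 * n + 1))"
    by (rule range_inj_infinite) (simp add: inj_def)
  ultimately show ?thesis
    by (auto simp: set_L_iff strict_mono_def dest: finite_subset)
qed

text \<open>The terms of even index in the increasing enumeration of \<open>C\<close> form one infinite half, and those
  of odd index lie in the other.\<close>

lemma infinite_nat_set_split:
  fixes C :: "nat set"
  assumes "infinite C"
  obtains A B where "A \<union> B = C" "A \<inter> B = {}" "infinite A" "infinite B"
proof -
  let ?e = "enumerate C"
  have inj: "inj ?e"
    using strict_mono_enumerate[OF assms] by (rule strict_mono_imp_inj_on)
  define A where "A = range (\<lambda>n. ?e (2 * n))"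
  define B where "B = C - A"
  have "range (\<lambda>n. ?e (2 * n + 1)) \<subseteq> B"
  proof
    fix x assume "x \<in> range (\<lambda>n. ?e (2 * n + 1))"
    then obtain n where x: "x = ?e (2 * n + 1)" by blast
    have "2 * n + 1 \<noteq> 2 * m" for m by presburger
    then have "x \<notin> A"
      unfolding A_def x using inj by (auto simp: inj_eq)
    then show "x \<in> B"
      using x enumerate_in_set[OF assms] by (simp add: B_def)
  qed
  moreover have "infinite (range (\<lambda>n. ?e (2 * n + 1)))"
    by (rule range_inj_infinite) (use inj in \<open>auto intro!: injI simp: inj_eq\<close>)
  ultimately have "infinite B"
    by (rule infinite_super)
  moreover have "infinite A"
    unfolding A_def by (rule range_inj_infinite) (use inj in \<open>auto intro!: injI simp: inj_eq\<close>)
  moreover have "A \<subseteq> C"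
    unfolding A_def using enumerate_in_set[OF assms] by blast
  ultimately show thesis
    by (intro that[of A B]) (auto simp: B_def)
qed

text \<open>The factorization enlarges the image of \<open>w\<close> by half of its complement: the half that is added
  pulls back along the left factor to the co-image of the right one, and the half that is left out is
  the co-image of the left factor.\<close>

lemma set_L_factorization:
  assumes "w \<in> set_L"
  obtains u v where "u \<in> set_L" "v \<in> set_L" "w = u \<circ> v"
proof -
  have w: "strict_mono w" "infinite (- range w)"
    using assms by (auto simp: set_L_iff)
  obtain A B where AB: "A \<union> B = - range w" "A \<inter> B = {}" "infinite A" "infinite B"
    using infinite_nat_set_split[OF w(2)] .
  have sub: "A \<subseteq> - B" "range w \<subseteq> - B"
    using AB by auto
  have inf: "infinite (- B)"
    using AB(3) sub(1) by (rule infinite_super[rotated])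
  define u where "u = enumerate (- B)"
  have u: "strict_mono u" "range u = - B"
    unfolding u_def using inf by (simp_all add: strict_mono_enumerate range_enumerate)
  define v where "v = inv u \<circ> w"
  have uv: "u (v n) = w n" for n
    unfolding v_def using sub(2) u(2) by (simp add: f_inv_into_f image_subset_iff)
  have "strict_mono v"
  proof (rule strict_monoI)
    fix m n :: nat
    assume "m < n"
    then have "u (v m) < u (v n)"
      unfolding uv using w(1) by (rule strict_monoD[rotated])
    then show "v m < v n"
      using u(1) by (simp add: strict_mono_less)
  qed
  moreover have "infinite (- range v)"
  proof
    assume "finite (- range v)"
    moreover have "A \<subseteq> u ` (- range v)"
    proof
      fix a assume a: "a \<in> A"
      then obtain k where k: "a = u k"
        using sub(1) u(2) by blast
      have "k \<notin> range v"
        using a k uv AB(1) by auto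
      then show "a \<in> u ` (- range v)"
        using k by blast
    qed
    ultimately show False
      using AB(3) finite_surj by blast
  qed
  moreover have "u \<in> set_L"
    using u AB(4) by (simp add: set_L_iff)
  moreover have "w = u \<circ> v"
    using uv by auto
  ultimately show thesis
    using that[of u v] by (simp add: set_L_iff)
qed

theorem theorem3p4:
  shows "(is_two_sided_ideal set_L \<and> is_idempotent set_L)
       \<and> (\<forall>u\<in>submonoid_F. ideal_quotient u set_L = set_L)
       \<and> set_L \<in> double_negation_topology"
proof -
  have sub: "set_L \<subseteq> monoid_E"
    by (auto simp: set_L_def)
  have two_sided: "is_two_sided_ideal set_L"
    unfolding is_two_sided_ideal_def using sub by (auto simp: comp_in_set_L_iff subset_iff)
  have "set_comp set_L set_L \<subseteq> set_L"
    using two_sided sub by (auto simp: set_comp_def is_two_sided_ideal_def)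
  moreover have "set_L \<subseteq> set_comp set_L set_L"
    unfolding set_comp_def by (blast elim: set_L_factorization)
  ultimately have "is_idempotent set_L"
    by (simp add: is_idempotent_def)
  moreover have "ideal_quotient u set_L = set_L" if "u \<in> submonoid_F" for u
  proof -
    have "u \<in> monoid_E" "u \<notin> set_L"
      using that by (auto simp: submonoid_F_def set_L_def)
    then show ?thesis
      using sub by (auto simp: ideal_quotient_def comp_in_set_L_iff)
  qed
  moreover have "set_L \<in> double_negation_topology"
  proof -
    have "is_ideal set_L"
      using two_sided by (simp add: is_two_sided_ideal_def is_ideal_def)
    moreover have "\<exists>v\<in>monoid_E. u \<circ> v \<in> set_L" if "u \<in> monoid_E" for u
      using that double_in_set_L sub comp_in_set_L_iff by blast
    ultimately show ?thesis
      by (simp add: double_negation_topology_def)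
  qed
  ultimately show ?thesis
    using two_sided by blast
qed

end
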